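(* Let $r\ge2$ and $k_1,\ldots,k_r\ge2$. Then for every $n\ge1$, with $\zeta_n=e^{2\pi i/n}$, \[\sum_{j=1}^r\ \sum_{\substack{l_1,\ldots,l_{j-1}\ge2\\ l_j,\ldots,l_r\ge1}}\Big\{\prod_{p=1}^{j-1}\binom{k_p-2}{l_p-2}\Big\}\binom{k_j-2}{l_j-1}\Big\{\prod_{p=j+1}^r\binom{k_p-1}{l_p-1}\Big\}(1-\zeta_n)^{\sum_{p=1}^r(k_p-l_p)-1}\,\omega_n(l_1,\ldots,l_r;\zeta_n)=0;\] that is, the corresponding relation $\sum\cdots(1-\zeta)^{\sum_p(k_p-l_p)-1}\omega(l_1,\ldots,l_r)=0$ holds in $\mathcal{R}=\prod_{n\ge1}\mathbb{Q}(\zeta_n)$.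
   Context: For an index (tuple of positive integers) $\mathbf{l}=(l_1,\ldots,l_r)$ with $r\ge2$, $\omega_n(\mathbf{l};q)=\sum_{m_1+\cdots+m_r=n,\,m_i>0}\prod_{a=1}^r\frac{q^{(l_a-1)m_a}}{[m_a]^{l_a}}$ with $[m]=\frac{1-q^m}{1-q}$; since all $m_a<n$ it can be evaluated at a primitive $n$-th root of unity. In $\mathcal{R}=\prod_{n\ge1}\mathbb{Q}(\zeta_n)$, $\zeta=(\zeta_n)_n$ and $\omega(\mathbf{l})=(\omega_n(\mathbf{l};e^{2\pi i/n}))_n$. Binomial coefficients $\binom{a}{b}$ are zero unless $0\le b\le a$. *)

theory Defs
  imports
    Complex_Main
    "HOL-Library.FuncSet"
    "HOL-Library.Groups_Big_Fun"
    "HOL-Algebra.Generated_Fields"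
    "HOL-Algebra.Algebraic_Closure_Type"
begin

text \<open>Tuples \<open>(x\<^sub>1, \<dots>, x\<^sub>r)\<close> are functions on \<open>{1..r}\<close>, extended by \<open>undefined\<close>
  outside (extensional functions) wherever a set of tuples is summed over.\<close>

definition qint :: "'a::field \<Rightarrow> nat \<Rightarrow> 'a" where
  "qint q m = (1 - q ^ m) / (1 - q)"

definition compositions :: "nat \<Rightarrow> nat \<Rightarrow> (nat \<Rightarrow> nat) set" where
  "compositions r n = {m \<in> {1..r} \<rightarrow>\<^sub>E {1..}. (\<Sum>a=1..r. m a) = n}"

definition omega_n :: "nat \<Rightarrow> (nat \<Rightarrow> nat) \<Rightarrow> nat \<Rightarrow> 'a::field \<Rightarrow> 'a" where
  "omega_n r l n q =
     (\<Sum>m\<in>compositions r n. \<Prod>a=1..r. q ^ ((l a - 1) * m a) / qint q (m a) ^ l a)"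

definition zeta_n :: "nat \<Rightarrow> complex" where
  "zeta_n n = exp (2 * of_real pi * \<i> / of_nat n)"

definition index_range :: "nat \<Rightarrow> nat \<Rightarrow> (nat \<Rightarrow> nat) set" where
  "index_range r j =
     {l \<in> extensional {1..r}. (\<forall>p\<in>{1..<j}. l p \<ge> 2) \<and> (\<forall>p\<in>{j..r}. l p \<ge> 1)}"

definition binom_coeff :: "nat \<Rightarrow> (nat \<Rightarrow> nat) \<Rightarrow> nat \<Rightarrow> (nat \<Rightarrow> nat) \<Rightarrow> nat" where
  "binom_coeff r k j l =
     (\<Prod>p\<in>{1..<j}. (k p - 2) choose (l p - 2)) * ((k j - 2) choose (l j - 1)) *
     (\<Prod>p\<in>{j+1..r}. (k p - 1) choose (l p - 1))"

definition expo :: "nat \<Rightarrow> (nat \<Rightarrow> nat) \<Rightarrow> (nat \<Rightarrow> nat) \<Rightarrow> int" where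
  "expo r k l = (\<Sum>p=1..r. int (k p) - int (l p)) - 1"


text \<open>The sums over \<open>l\<close> range over infinite sets. The facts below show that only finitely
  many coefficients are nonzero, so that \<^const>\<open>Sum_any\<close> is the intended sum, and that the exponent
  of \<open>1 - \<zeta>\<close> is nonnegative whenever the coefficient is nonzero; in the product ring, where
  \<open>1 - \<zeta>\<close> is not a unit, it may therefore be read as a natural number.\<close>

lemma binom_coeff_nonzeroD:
  assumes k: "\<forall>p\<in>{1..r}. k p \<ge> 2" and j: "j \<in> {1..r}"
    and l: "l \<in> index_range r j" and nz: "binom_coeff r k j l \<noteq> 0"
  shows "\<forall>p\<in>{1..r}. l p \<le> k p" and "l j < k j"
proof -
  have jj: "l j - 1 \<le> k j - 2"
    using nz by (auto simp: binom_coeff_def not_less)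
  have "k j \<ge> 2" using k j by auto
  with jj show lj: "l j < k j" by linarith
  show "\<forall>p\<in>{1..r}. l p \<le> k p"
  proof
    fix p assume p: "p \<in> {1..r}"
    hence kp: "k p \<ge> 2" using k by auto
    consider "p < j" | "p = j" | "p > j" by linarith
    then show "l p \<le> k p"
    proof cases
      case 1
      hence "p \<in> {1..<j}" using p by auto
      hence "(k p - 2) choose (l p - 2) \<noteq> 0" using nz by (auto simp: binom_coeff_def)
      hence "l p - 2 \<le> k p - 2" by (simp add: not_less)
      then show ?thesis using kp by linarith
    next
      case 2 then show ?thesis using lj by simp
    next
      case 3
      hence "p \<in> {j+1..r}" using p by auto
      hence "(k p - 1) choose (l p - 1) \<noteq> 0" using nz by (auto simp: binom_coeff_def)
      hence "l p - 1 \<le> k p - 1" by (simp add: not_less)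
      then show ?thesis using kp by linarith
    qed
  qed
qed

lemma finite_binom_coeff_support:
  assumes "\<forall>p\<in>{1..r}. k p \<ge> 2" and "j \<in> {1..r}"
  shows "finite {l \<in> index_range r j. binom_coeff r k j l \<noteq> 0}"
proof (rule finite_subset)
  show "{l \<in> index_range r j. binom_coeff r k j l \<noteq> 0} \<subseteq> ({1..r} \<rightarrow>\<^sub>E {..Max (k ` {1..r})})"
  proof
    fix l assume "l \<in> {l \<in> index_range r j. binom_coeff r k j l \<noteq> 0}"
    hence l: "l \<in> index_range r j" "binom_coeff r k j l \<noteq> 0" by auto
    have "l p \<le> Max (k ` {1..r})" if "p \<in> {1..r}" for p
      using binom_coeff_nonzeroD(1)[OF assms l] that
      by (meson Max_ge finite_atLeastAtMost finite_imageI imageI order_trans)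
    thus "l \<in> {1..r} \<rightarrow>\<^sub>E {..Max (k ` {1..r})}"
      using l(1) by (auto simp: index_range_def PiE_def)
  qed
qed (auto intro: finite_PiE)

lemma expo_nonneg:
  assumes "\<forall>p\<in>{1..r}. k p \<ge> 2" and "j \<in> {1..r}"
    and "l \<in> index_range r j" and "binom_coeff r k j l \<noteq> 0"
  shows "expo r k l \<ge> 0"
proof -
  note le = binom_coeff_nonzeroD[OF assms]
  have "1 \<le> int (k j) - int (l j)" using le(2) by simp
  also have "\<dots> \<le> (\<Sum>p=1..r. int (k p) - int (l p))"
    using le(1) assms(2) by (intro member_le_sum) auto
  finally show ?thesis by (simp add: expo_def)
qed


text \<open>\<open>\<rat>(\<zeta>\<^sub>n)\<close> as the subfield of the complex numbers generated by \<open>\<zeta>\<^sub>n\<close>.\<close>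

definition cyc_field :: "nat \<Rightarrow> complex set" where
  "cyc_field n = generate_field (ring_of_type_algebra :: complex ring) {zeta_n n}"

lemma cyc_field_one: "1 \<in> cyc_field n"
  using generate_field.one[of "ring_of_type_algebra :: complex ring" "{zeta_n n}"]
  by (simp add: cyc_field_def ring_of_type_algebra_def)

lemma cyc_field_zeta: "zeta_n n \<in> cyc_field n"
  by (auto simp: cyc_field_def intro: generate_field.incl)

lemma cyc_field_add: "x \<in> cyc_field n \<Longrightarrow> y \<in> cyc_field n \<Longrightarrow> x + y \<in> cyc_field n"
  using generate_field.eng_add[of x "ring_of_type_algebra :: complex ring" "{zeta_n n}" y]
  by (simp add: cyc_field_def ring_of_type_algebra_def)

lemma cyc_field_mult: "x \<in> cyc_field n \<Longrightarrow> y \<in> cyc_field n \<Longrightarrow> x * y \<in> cyc_field n"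
  using generate_field.eng_mult[of x "ring_of_type_algebra :: complex ring" "{zeta_n n}" y]
  by (simp add: cyc_field_def ring_of_type_algebra_def)

lemma cyc_field_uminus:
  assumes "x \<in> cyc_field n" shows "- x \<in> cyc_field n"
proof -
  let ?R = "ring_of_type_algebra :: complex ring"
  interpret field ?R by (rule field_from_type_algebra)
  have "\<ominus>\<^bsub>?R\<^esub> x = - x"
    by (rule minus_equality) (auto simp: ring_of_type_algebra_def)
  thus ?thesis
    using generate_field.a_inv[of x ?R "{zeta_n n}"] assms by (simp add: cyc_field_def)
qed

lemma cyc_field_zero: "0 \<in> cyc_field n"
  using cyc_field_add[OF cyc_field_one cyc_field_uminus[OF cyc_field_one], of n] by simp

lemma cyc_field_diff: "x \<in> cyc_field n \<Longrightarrow> y \<in> cyc_field n \<Longrightarrow> x - y \<in> cyc_field n"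
  using cyc_field_add[of x n "- y"] cyc_field_uminus by simp

lemma cyc_field_inverse:
  assumes "x \<in> cyc_field n" shows "inverse x \<in> cyc_field n"
proof (cases "x = 0")
  case True
  thus ?thesis using cyc_field_zero by simp
next
  case False
  let ?R = "ring_of_type_algebra :: complex ring"
  interpret field ?R by (rule field_from_type_algebra)
  have "inv\<^bsub>?R\<^esub> x = inverse x"
    by (rule comm_inv_char) (use False in \<open>auto simp: ring_of_type_algebra_def\<close>)
  thus ?thesis
    using generate_field.m_inv[of x ?R "{zeta_n n}"] assms False
    by (simp add: cyc_field_def ring_of_type_algebra_def)
qed

lemma cyc_field_divide: "x \<in> cyc_field n \<Longrightarrow> y \<in> cyc_field n \<Longrightarrow> x / y \<in> cyc_field n"
  by (simp add: divide_inverse cyc_field_mult cyc_field_inverse)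

lemma cyc_field_power: "x \<in> cyc_field n \<Longrightarrow> x ^ e \<in> cyc_field n"
  by (induction e) (auto intro: cyc_field_one cyc_field_mult)

lemma cyc_field_sum: "(\<And>i. i \<in> A \<Longrightarrow> f i \<in> cyc_field n) \<Longrightarrow> sum f A \<in> cyc_field n"
  by (induction A rule: infinite_finite_induct) (auto intro: cyc_field_zero cyc_field_add)

lemma cyc_field_prod: "(\<And>i. i \<in> A \<Longrightarrow> f i \<in> cyc_field n) \<Longrightarrow> prod f A \<in> cyc_field n"
  by (induction A rule: infinite_finite_induct) (auto intro: cyc_field_one cyc_field_mult)

lemma omega_n_in_cyc_field: "omega_n r l n (zeta_n n) \<in> cyc_field n"
  unfolding omega_n_def qint_def
  by (intro cyc_field_sum cyc_field_prod cyc_field_divide cyc_field_power cyc_field_diff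
        cyc_field_one cyc_field_zeta)

text \<open>The ring \<open>\<R> = \<Prod>\<^bsub>n\<ge>1\<^esub> \<rat>(\<zeta>\<^sub>n)\<close>. There is no component of index \<open>0\<close>; that junk
  value is fixed to be \<open>0\<close>.\<close>

typedef cyc_prod = "{f :: nat \<Rightarrow> complex. f 0 = 0 \<and> (\<forall>n\<ge>1. f n \<in> cyc_field n)}"
  by (rule exI[of _ "\<lambda>_. 0"]) (auto intro: cyc_field_zero)

setup_lifting type_definition_cyc_prod

instantiation cyc_prod :: comm_ring_1
begin

lift_definition zero_cyc_prod :: cyc_prod is "\<lambda>n. 0"
  by (auto intro: cyc_field_zero)

lift_definition one_cyc_prod :: cyc_prod is "\<lambda>n. if n = 0 then 0 else 1"
  by (auto intro: cyc_field_one)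

lift_definition plus_cyc_prod :: "cyc_prod \<Rightarrow> cyc_prod \<Rightarrow> cyc_prod" is "\<lambda>f g n. f n + g n"
  by (auto intro: cyc_field_add)

lift_definition minus_cyc_prod :: "cyc_prod \<Rightarrow> cyc_prod \<Rightarrow> cyc_prod" is "\<lambda>f g n. f n - g n"
  by (auto intro: cyc_field_diff)

lift_definition uminus_cyc_prod :: "cyc_prod \<Rightarrow> cyc_prod" is "\<lambda>f n. - f n"
  by (auto intro: cyc_field_uminus)

lift_definition times_cyc_prod :: "cyc_prod \<Rightarrow> cyc_prod \<Rightarrow> cyc_prod" is "\<lambda>f g n. f n * g n"
  by (auto intro: cyc_field_mult)

instance
proof
  fix a b c :: cyc_prod
  show "a + b + c = a + (b + c)" by transfer (simp add: add.assoc)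
  show "a + b = b + a" by transfer (simp add: add.commute)
  show "0 + a = a" by transfer simp
  show "- a + a = 0" by transfer simp
  show "a - b = a + - b" by transfer simp
  show "a * b * c = a * (b * c)" by transfer (simp add: mult.assoc)
  show "a * b = b * a" by transfer (simp add: mult.commute)
  show "1 * a = a" by transfer (auto simp: fun_eq_iff)
  show "(a + b) * c = a * c + b * c" by transfer (simp add: distrib_right)
  show "(0::cyc_prod) \<noteq> 1" by transfer (auto simp: fun_eq_iff)
qed

end

lift_definition zeta :: cyc_prod is "\<lambda>n. if n = 0 then 0 else zeta_n n"
  by (auto intro: cyc_field_zeta)

lift_definition omega :: "nat \<Rightarrow> (nat \<Rightarrow> nat) \<Rightarrow> cyc_prod"
  is "\<lambda>r l n. if n = 0 then 0 else omega_n r l n (zeta_n n)"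
  by (auto intro: omega_n_in_cyc_field)

end

theory Submission
  imports Defs "HOL-Analysis.Complex_Transcendental"
begin

text \<open>With \<open>u\<^sub>p = 1 / (1 - q\<^bsup>m\<^sub>p\<^esup>)\<close> one has
  \<open>q\<^bsup>(l-1)m\<^sub>p\<^esup> / [m\<^sub>p]\<^sup>l = (1 - q)\<^sup>l (u\<^sub>p - 1)\<^bsup>l-1\<^esup> u\<^sub>p\<close>, so after exchanging the sums over
  \<open>l\<close> and \<open>m\<close> the binomial theorem evaluates each sum over \<open>l\<^sub>p\<close>. Up to a power of \<open>1 - q\<close>, what
  remains for each composition \<open>m\<close> is \<open>\<Prod>\<^sub>p u\<^sub>p\<^bsup>k\<^sub>p-1\<^esup>\<close> times
  \<open>\<Sum>\<^sub>j (\<Prod>\<^bsub>p<j\<^esub> (u\<^sub>p - 1)) (\<Prod>\<^bsub>p>j\<^esub> u\<^sub>p)\<close>. The latter telescopes to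
  \<open>\<Prod>\<^sub>p u\<^sub>p - \<Prod>\<^sub>p (u\<^sub>p - 1) = (1 - q\<^sup>n) \<Prod>\<^sub>p u\<^sub>p\<close>, which vanishes because \<open>q\<^sup>n = 1\<close>.\<close>

section \<open>Telescoping products and shifted binomial sums\<close>

text \<open>Summand \<open>j\<close> is the difference of two neighbouring hybrid products, with
  \<open>b\<close> on the first \<open>j - 1\<close> or \<open>j\<close> positions and
  \<open>a\<close> on the rest. It is used with \<open>a = u\<close> and \<open>b = u - 1\<close>,
  so that the middle factor is 1.\<close>

lemma sum_prod_telescope:
  fixes a b :: "nat \<Rightarrow> 'a::comm_ring_1"
  shows "(\<Sum>j=1..r. \<Prod>p=1..r. if p < j then b p else if p = j then a p - b p else a p) =
    (\<Prod>p=1..r. a p) - (\<Prod>p=1..r. b p)"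
proof (induction r)
  case 0
  show ?case by simp
next
  case (Suc r)
  let ?f = "\<lambda>j p. if p < j then b p else if p = j then a p - b p else a p"
  have "(\<Sum>j=1..Suc r. \<Prod>p=1..Suc r. ?f j p) =
      (\<Sum>j=1..r. (\<Prod>p=1..r. ?f j p) * ?f j (Suc r)) + (\<Prod>p=1..r. ?f (Suc r) p) * ?f (Suc r) (Suc r)"
    by simp
  also have "(\<Sum>j=1..r. (\<Prod>p=1..r. ?f j p) * ?f j (Suc r)) =
      (\<Sum>j=1..r. \<Prod>p=1..r. ?f j p) * a (Suc r)"
    unfolding sum_distrib_right by (intro sum.cong) auto
  also have "(\<Prod>p=1..r. ?f (Suc r) p) = (\<Prod>p=1..r. b p)"
    by (intro prod.cong) auto
  finally show ?case unfolding Suc.IH by (simp add: algebra_simps)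
qed

lemma sum_choose_shift:
  fixes y :: "'a::comm_semiring_1"
  assumes "N + a \<le> k"
  shows "(\<Sum>l=a..k. of_nat (N choose (l - a)) * y ^ (l - a)) = (1 + y) ^ N"
proof -
  have "(1 + y) ^ N = (\<Sum>i\<le>N. of_nat (N choose i) * y ^ i)"
    using binomial_ring[of y 1 N] by (simp add: add.commute)
  also have "\<dots> = (\<Sum>i\<le>k-a. of_nat (N choose i) * y ^ i)"
    using assms by (intro sum.mono_neutral_left) (auto simp: binomial_eq_0)
  also have "\<dots> = (\<Sum>l=a..k. of_nat (N choose (l - a)) * y ^ (l - a))"
    by (rule sum.reindex_bij_witness[of _ "\<lambda>l. l - a" "\<lambda>i. i + a"]) (use assms in auto)
  finally show ?thesis by simp
qed

section \<open>Reduction of the infinite sums over \<open>l\<close> to finite boxes\<close>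

definition index_factor :: "(nat \<Rightarrow> nat) \<Rightarrow> nat \<Rightarrow> nat \<Rightarrow> nat \<Rightarrow> nat" where
  "index_factor k j p l =
     (if p < j then (k p - 2) choose (l - 2)
      else if p = j then (k p - 2) choose (l - 1) else (k p - 1) choose (l - 1))"

text \<open>The box is a product set so that a sum over it of products of one-variable factors
  splits into a product of sums.\<close>

definition index_box :: "nat \<Rightarrow> (nat \<Rightarrow> nat) \<Rightarrow> nat \<Rightarrow> (nat \<Rightarrow> nat) set" where
  "index_box r k j = (\<Pi>\<^sub>E p\<in>{1..r}. {(if p < j then 2 else 1)..k p})"

lemma finite_index_box: "finite (index_box r k j)"
  unfolding index_box_def by (intro finite_PiE) auto

lemma index_box_subset_index_range:
  assumes "j \<in> {1..r}"
  shows "index_box r k j \<subseteq> index_range r j"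
proof
  fix l assume l: "l \<in> index_box r k j"
  have le: "(if p < j then 2 else 1) \<le> l p" if "p \<in> {1..r}" for p
    using l that unfolding index_box_def PiE_iff by simp
  have "2 \<le> l p" if "p \<in> {1..<j}" for p
    using le[of p] that assms by simp
  moreover have "1 \<le> l p" if "p \<in> {j..r}" for p
    using le[of p] that assms by (simp split: if_splits)
  moreover have "l \<in> extensional {1..r}"
    using l by (simp add: index_box_def PiE_iff)
  ultimately show "l \<in> index_range r j"
    by (simp add: index_range_def)
qed

lemma binom_coeff_eq_prod:
  assumes "j \<in> {1..r}"
  shows "binom_coeff r k j l = (\<Prod>p=1..r. index_factor k j p (l p))"
proof -
  have "{1..r} = {1..<j} \<union> ({j} \<union> {j+1..r})" using assms by auto
  hence "(\<Prod>p=1..r. index_factor k j p (l p)) =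
      (\<Prod>p\<in>{1..<j} \<union> ({j} \<union> {j+1..r}). index_factor k j p (l p))" by simp
  also have "\<dots> = (\<Prod>p\<in>{1..<j}. index_factor k j p (l p)) *
      (index_factor k j j (l j) * (\<Prod>p\<in>{j+1..r}. index_factor k j p (l p)))"
    by (subst prod.union_disjoint, auto)
  also have "\<dots> = binom_coeff r k j l"
    by (simp add: binom_coeff_def index_factor_def mult.assoc)
  finally show ?thesis by simp
qed

text \<open>A nonzero coefficient forces \<open>l p\<close> \<le> \<open>k p\<close>, so the support
  of \<open>f\<close> lies in the box. The values of \<open>f\<close> stay abstract because both
  complex numbers and elements of \<open>cyc_prod\<close> are summed later.\<close>

lemma Sum_any_index_range:
  fixes f :: "(nat \<Rightarrow> nat) \<Rightarrow> 'a::comm_ring_1"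
  assumes k: "\<forall>p\<in>{1..r}. k p \<ge> 2" and j: "j \<in> {1..r}"
    and f: "\<And>l. l \<in> index_range r j \<Longrightarrow> binom_coeff r k j l = 0 \<Longrightarrow> f l = 0"
  shows "Sum_any (\<lambda>l. if l \<in> index_range r j then f l else 0) = (\<Sum>l\<in>index_box r k j. f l)"
proof -
  have "l \<in> index_box r k j" if l: "l \<in> index_range r j" and "f l \<noteq> 0" for l
  proof -
    have "binom_coeff r k j l \<noteq> 0" using f that by blast
    from binom_coeff_nonzeroD(1)[OF k j l this] l show ?thesis
      by (auto simp: index_box_def index_range_def PiE_iff)
  qed
  hence "Sum_any (\<lambda>l. if l \<in> index_range r j then f l else 0) =
      (\<Sum>l\<in>index_box r k j. if l \<in> index_range r j then f l else 0)"
    by (intro Sum_any.expand_superset finite_index_box) auto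
  also have "\<dots> = (\<Sum>l\<in>index_box r k j. f l)"
    using index_box_subset_index_range[OF j] by (intro sum.cong) auto
  finally show ?thesis .
qed

section \<open>Evaluation of the sums for a fixed composition\<close>

lemma sum_index_factor:
  fixes q :: "'a::field"
  assumes k: "k p \<ge> 2" and m: "q ^ m \<noteq> 1"
  defines "u \<equiv> 1 / (1 - q ^ m)"
  shows "(\<Sum>l=(if p < j then 2 else 1)..k p. of_nat (index_factor k j p l) *
            (1 - q) powi (int (k p) - int l) * (q ^ ((l - 1) * m) / qint q m ^ l)) =
      (1 - q) ^ k p * u ^ (k p - 1) * (if p < j then u - 1 else if p = j then 1 else u)"
    (is "?lhs = _")
proof -
  \<comment> \<open>With these \<open>s\<close> and \<open>N\<close>, all three cases of
    \<open>index_factor\<close> read \<open>N choose (l - s)\<close>. Taking out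
    \<open>u * (u - 1) ^ (s - 1)\<close> leaves the binomial expansion of
    \<open>(1 + (u - 1)) ^ N = u ^ N\<close>.\<close>
  define s :: nat where "s = (if p < j then 2 else 1)"
  define N where "N = (if p \<le> j then k p - 2 else k p - 1)"
  have s1: "s \<ge> 1" by (simp add: s_def)
  have Ns: "N + s \<le> k p" using k by (auto simp: N_def s_def)
  have u1: "u - 1 = q ^ m * u" using m by (simp add: u_def field_simps)
  have "?lhs = (\<Sum>l=s..k p. (1 - q) ^ k p * u * (u - 1) ^ (s - 1) *
      (of_nat (N choose (l - s)) * (u - 1) ^ (l - s)))"
    unfolding s_def[symmetric]
  proof (rule sum.cong)
    fix l assume l: "l \<in> {s..k p}"
    have c: "index_factor k j p l = N choose (l - s)"
      by (auto simp: index_factor_def N_def s_def)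
    have pw: "(1 - q) powi (int (k p) - int l) = (1 - q) ^ (k p - l)"
      using l by (simp flip: of_nat_diff)
    have y: "(u - 1) ^ (l - 1) = (u - 1) ^ (s - 1) * (u - 1) ^ (l - s)"
      using l s1 by (simp flip: power_add)
    have "u * u ^ (l - 1) = u ^ l" using l s1 by (cases l) auto
    hence "u * (u - 1) ^ (l - 1) = q ^ ((l - 1) * m) * u ^ l" unfolding u1
      by (simp add: power_mult_distrib mult.commute[of _ m] power_mult mult.left_commute)
    hence "q ^ ((l - 1) * m) / qint q m ^ l = (1 - q) ^ l * (u * (u - 1) ^ (l - 1))"
      by (simp add: qint_def u_def power_divide)
    \<comment> \<open>The power \<open>(1 - q) ^ l\<close> released by
      \<open>1 / qint q m ^ l\<close> makes the total power of \<open>1 - q\<close> independent of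
      \<open>l\<close>.\<close>
    moreover have "(1 - q) ^ k p = (1 - q) ^ (k p - l) * (1 - q) ^ l"
      using l by (simp flip: power_add)
    ultimately show "of_nat (index_factor k j p l) * (1 - q) powi (int (k p) - int l) *
        (q ^ ((l - 1) * m) / qint q m ^ l) =
        (1 - q) ^ k p * u * (u - 1) ^ (s - 1) * (of_nat (N choose (l - s)) * (u - 1) ^ (l - s))"
      unfolding c pw y by (simp only: mult_ac)
  qed simp
  also have "\<dots> = (1 - q) ^ k p * u * (u - 1) ^ (s - 1) * u ^ N"
    using sum_choose_shift[OF Ns, of "u - 1"] by (simp flip: sum_distrib_left)
  also have "\<dots> = (1 - q) ^ k p * u ^ (k p - 1) * (if p < j then u - 1 else if p = j then 1 else u)"
  proof -
    obtain i where "k p = Suc (Suc i)" using k by (metis add_2_eq_Suc le_Suc_ex)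
    thus ?thesis by (auto simp: N_def s_def)
  qed
  finally show ?thesis .
qed

lemma powi_sum:
  fixes x :: "'a::field"
  assumes "x \<noteq> 0"
  shows "x powi (\<Sum>i\<in>A. f i) = (\<Prod>i\<in>A. x powi f i)"
  using assms by (induction A rule: infinite_finite_induct) (auto simp: power_int_add)

text \<open>Since \<open>r\<close> \<ge> 2, a second positive part keeps \<open>m p\<close> below
  \<open>n\<close>; primitivity then gives \<open>q ^ m p\<close> \<noteq> 1, so no denominator
  vanishes.\<close>

lemma compositions_less:
  assumes "r \<ge> 2" "m \<in> compositions r n" "p \<in> {1..r}"
  shows "0 < m p" "m p < n"
proof -
  have pos: "m a \<ge> 1" if "a \<in> {1..r}" for a
    using assms(2) that by (auto simp: compositions_def PiE_iff)
  show "0 < m p" using pos[OF assms(3)] by simp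
  obtain b where b: "b \<in> {1..r}" "b \<noteq> p"
    using assms(1) that[of "if p = 1 then 2 else 1"] by (auto split: if_splits)
  have "m p < m p + m b" using pos[OF b(1)] by simp
  also have "\<dots> = (\<Sum>a\<in>{p,b}. m a)" using b by simp
  also have "\<dots> \<le> (\<Sum>a=1..r. m a)" using b assms(3) by (intro sum_mono2) auto
  also have "\<dots> = n" using assms(2) by (simp add: compositions_def)
  finally show "m p < n" .
qed

lemma sum_index_box_omega_n:
  fixes q :: "'a::field"
  assumes r: "r \<ge> 2" and k: "\<forall>p\<in>{1..r}. k p \<ge> 2"
    and qn: "q ^ n = 1" and prim: "\<And>m. 0 < m \<Longrightarrow> m < n \<Longrightarrow> q ^ m \<noteq> 1"
  shows "(\<Sum>j=1..r. \<Sum>l\<in>index_box r k j.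
      of_nat (binom_coeff r k j l) * (1 - q) powi (expo r k l) * omega_n r l n q) = 0"
\<comment> \<open>The empty case covers \<open>n = 1\<close>, where \<open>q = 1\<close>; it is
  split off because the argument below divides by \<open>1 - q\<close>.\<close>
proof (cases "compositions r n = {}")
  case True
  thus ?thesis by (simp add: omega_n_def)
next
  case False
  then obtain m0 where "m0 \<in> compositions r n" by blast
  from compositions_less[OF r this, of 1] r have "1 < n" by simp
  with prim[of 1] have q1: "q \<noteq> 1" by simp
  define F where "F m j p l = of_nat (index_factor k j p l) * (1 - q) powi (int (k p) - int l) *
      (q ^ ((l - 1) * m p) / qint q (m p) ^ l)" for m :: "nat \<Rightarrow> nat" and j p l
  have summand: "of_nat (binom_coeff r k j l) * (1 - q) powi (expo r k l) * omega_n r l n q =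
      (\<Sum>m\<in>compositions r n. (\<Prod>p=1..r. F m j p (l p)) / (1 - q))" if "j \<in> {1..r}" for j l
  proof -
    \<comment> \<open>The division by \<open>1 - q\<close> accounts for the \<open>- 1\<close> in
      \<open>expo\<close>; the rest of the exponent is distributed over the factors
      \<open>F\<close>.\<close>
    have "(1 - q) powi (expo r k l) = (\<Prod>p=1..r. (1 - q) powi (int (k p) - int (l p))) / (1 - q)"
      using q1 by (simp add: expo_def power_int_diff powi_sum)
    thus ?thesis
      by (simp add: binom_coeff_eq_prod[OF that] omega_n_def F_def prod.distrib prod_dividef sum_distrib_left
        mult.commute[of "1 - q"])
  qed
  have "(\<Sum>j=1..r. \<Sum>l\<in>index_box r k j.
      of_nat (binom_coeff r k j l) * (1 - q) powi (expo r k l) * omega_n r l n q) =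
    (\<Sum>j=1..r. \<Sum>l\<in>index_box r k j. \<Sum>m\<in>compositions r n. (\<Prod>p=1..r. F m j p (l p)) / (1 - q))"
    by (intro sum.cong refl summand)
  also have "\<dots> = (\<Sum>m\<in>compositions r n.
      (\<Sum>j=1..r. \<Sum>l\<in>index_box r k j. \<Prod>p=1..r. F m j p (l p)) / (1 - q))"
    by (subst sum.swap[of _ "compositions r n"], subst sum.swap[of _ "compositions r n"])
      (simp add: sum_divide_distrib)
  also have "\<dots> = 0"
  proof (intro sum.neutral ballI)
    fix m assume m: "m \<in> compositions r n"
    define u where "u p = 1 / (1 - q ^ m p)" for p
    have nz: "q ^ m p \<noteq> 1" if "p \<in> {1..r}" for p
      using compositions_less[OF r m that] prim by blast
    have "(\<Sum>j=1..r. \<Sum>l\<in>index_box r k j. \<Prod>p=1..r. F m j p (l p)) =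
        (\<Sum>j=1..r. \<Prod>p=1..r. \<Sum>l=(if p < j then 2 else 1)..k p. F m j p l)"
      unfolding index_box_def by (subst prod_sum_PiE) auto
    \<comment> \<open>The factor 1 at \<open>p = j\<close> is written as
      \<open>u p - (u p - 1)\<close> to match \<open>sum_prod_telescope\<close>.\<close>
    also have "\<dots> = (\<Sum>j=1..r. \<Prod>p=1..r. (1 - q) ^ k p * u p ^ (k p - 1) *
        (if p < j then u p - 1 else if p = j then u p - (u p - 1) else u p))"
      unfolding F_def u_def
      by (intro sum.cong prod.cong refl, subst sum_index_factor) (use k nz in auto)
    also have "\<dots> = (\<Prod>p=1..r. (1 - q) ^ k p * u p ^ (k p - 1)) *
        ((\<Prod>p=1..r. u p) - (\<Prod>p=1..r. u p - 1))"
      unfolding sum_prod_telescope[symmetric] prod.distrib sum_distrib_left ..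
    also have "(\<Prod>p=1..r. u p - 1) = (\<Prod>p=1..r. q ^ m p * u p)"
      by (rule prod.cong) (use nz in \<open>auto simp: u_def field_simps\<close>)
    also have "\<dots> = q ^ (\<Sum>p=1..r. m p) * (\<Prod>p=1..r. u p)"
      by (simp add: prod.distrib power_sum)
    also have "(\<Sum>p=1..r. m p) = n" using m by (simp add: compositions_def)
    finally show "(\<Sum>j=1..r. \<Sum>l\<in>index_box r k j. \<Prod>p=1..r. F m j p (l p)) / (1 - q) = 0"
      by (simp add: qn)
  qed
  finally show ?thesis .
qed

section \<open>Specialization to roots of unity and passage to the product ring\<close>

lemma zeta_n_power_eq_1_iff:
  assumes "n \<ge> 1"
  shows "zeta_n n ^ m = 1 \<longleftrightarrow> n dvd m"
proof -
  have "zeta_n n ^ m = exp (2 * of_real pi * \<i> * of_nat m / of_nat n)"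
    by (simp add: zeta_n_def mult_ac flip: exp_of_nat_mult)
  thus ?thesis
    using assms complex_root_unity_eq_1[of n m] by (simp add: mult_ac)
qed

lemma Rep_cyc_prod_sum: "Rep_cyc_prod (sum f A) n = (\<Sum>a\<in>A. Rep_cyc_prod (f a) n)"
  by (induction A rule: infinite_finite_induct)
    (simp_all add: zero_cyc_prod.rep_eq plus_cyc_prod.rep_eq)

text \<open>Index 0 is excluded because the unit of \<open>cyc_prod\<close> has value 0 there, which
  breaks the case \<open>e = 0\<close>.\<close>

lemma Rep_cyc_prod_power: "n \<ge> 1 \<Longrightarrow> Rep_cyc_prod (x ^ e) n = Rep_cyc_prod x n ^ e"
  by (induction e) (simp_all add: one_cyc_prod.rep_eq times_cyc_prod.rep_eq)

lemma Rep_cyc_prod_of_nat: "n \<ge> 1 \<Longrightarrow> Rep_cyc_prod (of_nat e) n = of_nat e"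
  by (induction e)
    (simp_all add: zero_cyc_prod.rep_eq one_cyc_prod.rep_eq plus_cyc_prod.rep_eq)

lemma cyc_prod_eq_0I:
  assumes "\<And>n. n \<ge> 1 \<Longrightarrow> Rep_cyc_prod x n = 0"
  shows "x = 0"
proof -
  have "Rep_cyc_prod x n = 0" for n
    using assms[of n] Rep_cyc_prod[of x] by (cases "n = 0") auto
  thus ?thesis by (simp add: zero_cyc_prod.rep_eq fun_eq_iff flip: Rep_cyc_prod_inject)
qed

theorem theorem5p1:
  fixes r :: nat and k :: "nat \<Rightarrow> nat"
  assumes "r \<ge> 2" and "\<forall>p\<in>{1..r}. k p \<ge> 2"
  shows "(\<forall>n\<ge>1.
            (\<Sum>j=1..r. Sum_any (\<lambda>l.
               if l \<in> index_range r j
               then of_nat (binom_coeff r k j l) * (1 - zeta_n n) powi (expo r k l)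
                      * omega_n r l n (zeta_n n)
               else 0)) = 0)
       \<and> (\<Sum>j=1..r. Sum_any (\<lambda>l.
               if l \<in> index_range r j
               then of_nat (binom_coeff r k j l) * (1 - zeta) ^ nat (expo r k l) * omega r l
               else 0)) = 0"
proof -
  define f where "f n j l =
      of_nat (binom_coeff r k j l) * (1 - zeta_n n) powi (expo r k l) * omega_n r l n (zeta_n n)"
    for n j l
  define g where "g j l =
      of_nat (binom_coeff r k j l) * (1 - zeta) ^ nat (expo r k l) * omega r l" for j l
  have f0: "(\<Sum>j=1..r. \<Sum>l\<in>index_box r k j. f n j l) = 0" if n: "n \<ge> 1" for n
    unfolding f_def using zeta_n_power_eq_1_iff[OF n]
    by (intro sum_index_box_omega_n assms) (auto dest: dvd_imp_le)
  have "(\<Sum>j=1..r. Sum_any (\<lambda>l. if l \<in> index_range r j then f n j l else 0)) = 0"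
    if "n \<ge> 1" for n
  proof -
    have "(\<Sum>j=1..r. Sum_any (\<lambda>l. if l \<in> index_range r j then f n j l else 0)) =
        (\<Sum>j=1..r. \<Sum>l\<in>index_box r k j. f n j l)"
      by (intro sum.cong refl Sum_any_index_range assms) (auto simp: f_def)
    thus ?thesis using f0[OF that] by simp
  qed
  moreover have "(\<Sum>j=1..r. Sum_any (\<lambda>l. if l \<in> index_range r j then g j l else 0)) = 0"
  proof -
    have "(\<Sum>j=1..r. Sum_any (\<lambda>l. if l \<in> index_range r j then g j l else 0)) =
        (\<Sum>j=1..r. \<Sum>l\<in>index_box r k j. g j l)"
      by (intro sum.cong refl Sum_any_index_range assms) (auto simp: g_def)
    also have "\<dots> = 0"
    proof (rule cyc_prod_eq_0I)
      fix n :: nat assume n: "n \<ge> 1"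
      \<comment> \<open>The exponents \<open>nat (expo r k l)\<close> and \<open>expo r k l\<close>
        agree once \<open>expo r k l\<close> \<ge> 0, which a nonzero coefficient guarantees; for a
        zero coefficient both sides vanish.\<close>
      have gf: "Rep_cyc_prod (g j l) n = f n j l" if "j \<in> {1..r}" "l \<in> index_box r k j" for j l
      proof (cases "binom_coeff r k j l = 0")
        case True
        thus ?thesis by (simp add: f_def g_def zero_cyc_prod.rep_eq)
      next
        case False
        have "l \<in> index_range r j" using index_box_subset_index_range that by blast
        hence "expo r k l \<ge> 0" using expo_nonneg[OF assms(2) that(1)] False by blast
        thus ?thesis using n
          by (simp add: f_def g_def times_cyc_prod.rep_eq minus_cyc_prod.rep_eq one_cyc_prod.rep_eq
            zeta.rep_eq omega.rep_eq Rep_cyc_prod_power Rep_cyc_prod_of_nat power_int_def)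
      qed
      have "Rep_cyc_prod (\<Sum>j=1..r. \<Sum>l\<in>index_box r k j. g j l) n =
          (\<Sum>j=1..r. \<Sum>l\<in>index_box r k j. f n j l)"
        unfolding Rep_cyc_prod_sum by (intro sum.cong refl gf)
      thus "Rep_cyc_prod (\<Sum>j=1..r. \<Sum>l\<in>index_box r k j. g j l) n = 0" using f0[OF n] by simp
    qed
    finally show ?thesis .
  qed
  ultimately show ?thesis unfolding f_def g_def by blast
qed

end
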